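(* Let $(A_j)_{j\geq 1}$ be a sequence of pairwise disjoint countable dense subsets of $\mathbb R$, and let $(B_j)_{j\geq 1}$ be a sequence of pairwise disjoint countable dense subsets of $\mathbb C$. There exists a transcendental entire function $f$ such that, for every $j\geq 1$, the restriction $f|_{A_j}\colon A_j\to B_j$ is bijective and $f^{-1}(B_j)\cap\mathbb R=A_j$. Moreover, the set of such functions has the cardinality of the continuum.
   Context: A transcendental entire function is an entire function $f\colon\mathbb C\to\mathbb C$ that is not a polynomial. *)

theory Defs
  imports "HOL-Complex_Analysis.Complex_Analysis" "HOL-Library.Equipollence"
begin

definition transcendental_entire :: "(complex \<Rightarrow> complex) \<Rightarrow> bool" where
  "transcendental_entire f \<longleftrightarrow>
     f holomorphic_on UNIV \<and> \<not> (\<exists>p :: complex poly. \<forall>z. f z = poly p z)"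

text \<open>The real line sits inside the complex plane via \<^const>\<open>complex_of_real\<close>. Its image is
  \<open>\<real>\<close>, and each \<open>A j\<close> is identified with its image. Sequences are indexed from 1; the
  value at 0 is ignored.\<close>

definition maps_bijectively :: "(nat \<Rightarrow> real set) \<Rightarrow> (nat \<Rightarrow> complex set) \<Rightarrow> (complex \<Rightarrow> complex) \<Rightarrow> bool" where
  "maps_bijectively A B f \<longleftrightarrow>
     (\<forall>j\<ge>1. bij_betw f (complex_of_real ` A j) (B j) \<and>
             f -` B j \<inter> \<real> = complex_of_real ` A j)"

end

theory Submission
  imports Defs
begin

text \<open>A back-and-forth construction with polynomials \<open>p\<close>. Given finitely many pairs \<open>(a, b)\<close> with
  \<open>p a = b\<close>, let \<open>Q\<close> have double zeros at the points \<open>a\<close>, a zero at \<open>\<i>\<close>, and larger degree than \<open>p\<close>.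
  Passing to \<open>p + Q (l + m (z - a'))\<close> keeps the old values, and \<open>l = (b' - p a') / Q a'\<close> adds the pair
  \<open>(a', b')\<close>. This \<open>l\<close> can be made small: for given \<open>a'\<close> choose \<open>b'\<close> close to \<open>p a'\<close>; for given \<open>b'\<close>
  choose \<open>a'\<close> far out on the real line, where \<open>Q\<close> dominates \<open>p\<close>.
  The small parameter \<open>m\<close> is chosen off a null set (a finite union of smooth curves in the plane) so
  that every \<open>b\<close> is attained on the real line at its own \<open>a\<close> only, and simply. This persists
  on \<open>[-n, n]\<close> for all functions \<open>F\<close> with \<open>|F - p| \<le> e |Q|\<close> there, \<open>e\<close> small, so it passes to the limit.

  The value at \<open>\<i>\<close> is never changed and can be prescribed, which gives a continuum of limits; there are
  no more than that since an entire function is determined by the induced map from \<open>A 1\<close> to \<open>B 1\<close>.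
  No limit is a polynomial, because a polynomial maps the real line to a nowhere dense set.\<close>

section \<open>Polynomials with double zeros at the real nodes\<close>

text \<open>Adding a multiple of this polynomial changes neither the values nor the derivatives at
  the nodes, because the real zeros are double. The factor for \<open>\<i>\<close> freezes the value
  there and adds no real zero.\<close>

definition node_poly :: "real set \<Rightarrow> complex poly" where
  "node_poly S = [:-\<i>, 1:] * (\<Prod>a\<in>S. [:-of_real a, 1:]^2)"

lemma node_poly_ii [simp]: "poly (node_poly S) \<i> = 0"
  by (simp add: node_poly_def)

lemma node_poly_insert:
  "finite S \<Longrightarrow> a \<notin> S \<Longrightarrow> node_poly (insert a S) = node_poly S * [:-of_real a, 1:]^2"
  by (simp add: node_poly_def mult_ac del: mult_pCons_left mult_pCons_right)

lemma node_poly_real_eq_0_iff: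
  assumes "finite S"
  shows "poly (node_poly S) (of_real t) = 0 \<longleftrightarrow> t \<in> S"
proof -
  have "complex_of_real t - \<i> \<noteq> 0"
    by (auto simp: complex_eq_iff)
  then show ?thesis
    using assms by (auto simp: node_poly_def poly_prod algebra_simps)
qed

lemma node_poly_nonzero [simp]: "finite S \<Longrightarrow> node_poly S \<noteq> 0"
  by (simp add: node_poly_def del: mult_pCons_left mult_pCons_right)

text \<open>The cofactor \<open>r\<close> still vanishes at \<open>a\<close>; this protects an old
  solution from losing simplicity under a perturbation.\<close>

lemma node_poly_factor:
  assumes "finite S" "a \<in> S"
  obtains r where "node_poly S = [:-of_real a, 1:] * r" "poly r (of_real a) = 0"
proof
  let ?r = "[:-of_real a, 1:] * node_poly (S - {a})"
  show "node_poly S = [:-of_real a, 1:] * ?r"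
    using node_poly_insert[of "S - {a}" a] assms
    by (simp add: insert_absorb power2_eq_square mult_ac del: mult_pCons_left mult_pCons_right)
  show "poly ?r (of_real a) = 0"
    by simp
qed

section \<open>Simple real solutions and their stability\<close>

text \<open>This says that \<open>p\<close> takes the value \<open>b\<close> on the real line at \<open>a\<close> only, and that this is a
  simple solution. Simplicity is what makes the property stable under small perturbations that
  vanish at \<open>a\<close>.\<close>

definition simply_attains :: "complex poly \<Rightarrow> real \<Rightarrow> complex \<Rightarrow> bool" where
  "simply_attains p a b \<longleftrightarrow>
     (\<exists>q. p = [:b:] + [:-of_real a, 1:] * q \<and> (\<forall>t::real. poly q (of_real t) \<noteq> 0))"

lemma simply_attains_eq: "simply_attains p a b \<Longrightarrow> poly p (of_real a) = b"
  by (auto simp: simply_attains_def)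

lemma eventually_at_right_0_mult_less:
  fixes c d :: real
  assumes "d > 0"
  shows "eventually (\<lambda>e. e * c < d) (at_right 0)"
proof -
  have "((\<lambda>e. e * c) \<longlongrightarrow> 0 * c) (at_right 0)"
    by (intro tendsto_intros)
  then show ?thesis
    using order_tendstoD(2)[of _ "0 * c"] assms by simp
qed

text \<open>Both sides contain the factor \<open>|t - a|\<close>. Cancelling it leaves a comparison
  of the cofactors \<open>r\<close> and \<open>q\<close>, and \<open>|r| / |q|\<close> is bounded on
  the compact interval because \<open>q\<close> has no real zero.\<close>

lemma simply_attains_stable:
  assumes "simply_attains p a b" "finite S" "a \<in> S"
  shows "eventually (\<lambda>e. \<forall>t\<in>{-R..R}. t \<noteq> a \<longrightarrow>
           e * norm (poly (node_poly S) (of_real t)) < norm (poly p (of_real t) - b)) (at_right 0)"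
proof -
  obtain q where q: "p = [:b:] + [:-of_real a, 1:] * q" "\<And>t::real. poly q (of_real t) \<noteq> 0"
    using assms(1) by (auto simp: simply_attains_def)
  obtain r where r: "node_poly S = [:-of_real a, 1:] * r"
    using node_poly_factor assms by metis
  have "continuous_on {-R..R} (\<lambda>t. norm (poly r (of_real t)) / norm (poly q (of_real t)))"
    using q(2) by (intro continuous_intros) auto
  then have "bounded ((\<lambda>t. norm (poly r (of_real t)) / norm (poly q (of_real t))) ` {-R..R})"
    by (intro compact_imp_bounded compact_continuous_image) auto
  then obtain M where M: "\<And>t. t \<in> {-R..R} \<Longrightarrow>
      norm (poly r (of_real t)) / norm (poly q (of_real t)) \<le> M"
    by (force simp: bounded_iff)
  have "eventually (\<lambda>e. e * M < 1) (at_right 0)"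
    by (rule eventually_at_right_0_mult_less) simp
  then show ?thesis
    using eventually_at_right_less[of 0]
  proof eventually_elim
    case (elim e)
    show ?case
    proof (intro ballI impI)
      fix t assume t: "t \<in> {-R..R}" "t \<noteq> a"
      have qt: "norm (poly q (of_real t)) > 0"
        using q(2) by simp
      have "norm (poly r (of_real t)) \<le> M * norm (poly q (of_real t))"
        using M[OF t(1)] qt by (simp add: divide_simps)
      then have "e * norm (poly r (of_real t)) \<le> e * M * norm (poly q (of_real t))"
        using elim by simp
      also have "\<dots> < norm (poly q (of_real t))"
        using elim qt by simp
      finally have "e * norm (poly r (of_real t)) < norm (poly q (of_real t))" .
      moreover have "norm (poly (node_poly S) (of_real t)) =
          norm (complex_of_real t - of_real a) * norm (poly r (of_real t))"
        by (simp add: r norm_mult[symmetric] algebra_simps del: mult_pCons_left)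
      moreover have "norm (poly p (of_real t) - b) =
          norm (complex_of_real t - of_real a) * norm (poly q (of_real t))"
        by (simp add: q(1) norm_mult[symmetric] algebra_simps del: mult_pCons_left)
      moreover have "norm (complex_of_real t - of_real a) > 0"
        using t by simp
      ultimately show "e * norm (poly (node_poly S) (of_real t)) < norm (poly p (of_real t) - b)"
        by (simp add: mult.left_commute[of e] mult.assoc)
    qed
  qed
qed

section \<open>Exceptional parameters form null sets\<close>

lemma negligible_real_curve:
  assumes "g differentiable_on S"
  shows "negligible ((g :: real \<Rightarrow> complex) ` S)"
  by (rule negligible_differentiable_image_lowdim[OF _ assms]) simp

lemma poly_of_real_differentiable [derivative_intros]:
  "(\<lambda>t. poly p (complex_of_real t)) differentiable (at t within S)"
proof (induction p)
  case (pCons c p)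
  have "complex_of_real differentiable (at t within S)"
    by (rule bounded_linear_imp_differentiable) (rule bounded_linear_of_real)
  with pCons show ?case
    by (auto intro!: differentiable_add differentiable_mult)
qed simp

text \<open>Solving for \<open>m\<close> gives \<open>m = - u(t) / v(t)\<close>, a differentiable
  curve in the plane with real parameter \<open>t\<close>.\<close>

lemma negligible_real_root_parameters:
  fixes u v :: "complex poly"
  shows "negligible {m. \<exists>t::real. poly v (of_real t) \<noteq> 0 \<and>
                          poly u (of_real t) + m * poly v (of_real t) = 0}" (is "negligible ?M")
proof -
  let ?S = "{t::real. poly v (of_real t) \<noteq> 0}"
  let ?g = "\<lambda>t::real. (- poly u (of_real t)) / poly v (of_real t)"
  have "?g differentiable_on ?S"
    by (auto simp: differentiable_on_def
        intro!: derivative_intros differentiable_divide differentiable_minus)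
  then have "negligible (?g ` ?S)"
    by (rule negligible_real_curve)
  moreover have "?M \<subseteq> ?g ` ?S"
  proof clarify
    fix m t
    assume v: "poly v (complex_of_real t) \<noteq> 0"
      and "poly u (of_real t) + m * poly v (of_real t) = 0"
    then have "m * poly v (of_real t) = - poly u (of_real t)"
      by (metis add.inverse_unique)
    with v have "m = ?g t"
      by (metis nonzero_eq_divide_eq)
    with v show "m \<in> ?g ` ?S"
      by blast
  qed
  ultimately show ?thesis
    using negligible_subset by blast
qed

text \<open>The added factor is \<open>l + m (z - a)\<close>, so the cofactor at \<open>a'\<close>
  becomes \<open>(q + l r) + m r (z - a)\<close>. A real zero \<open>t\<close> with
  \<open>r(t) (t - a) \<noteq> 0\<close> occurs only for \<open>m\<close> on a curve. Where
  \<open>r\<close> vanishes the cofactor equals \<open>q\<close>; at \<open>t = a\<close> it equals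
  \<open>(b - b') / (a - a')\<close>. Neither is zero.\<close>

lemma simply_attains_old_node:
  assumes "simply_attains p a' b'" "finite S" "a' \<in> S" "a \<notin> S"
    and other: "\<And>s. s \<in> S \<Longrightarrow> s \<noteq> a' \<Longrightarrow> poly p (of_real s) \<noteq> b'"
    and new: "poly p (of_real a) + l * poly (node_poly S) (of_real a) = b" "b \<noteq> b'"
  shows "negligible {m. \<not> simply_attains (p + node_poly S * [:l - m * of_real a, m:]) a' b'}"
proof -
  obtain q where q: "p = [:b':] + [:-of_real a', 1:] * q" "\<And>t::real. poly q (of_real t) \<noteq> 0"
    using assms(1) by (auto simp: simply_attains_def)
  obtain r where r: "node_poly S = [:-of_real a', 1:] * r" "poly r (of_real a') = 0"
    using node_poly_factor assms by metis
  let ?q = "\<lambda>m. q + r * [:l - m * of_real a, m:]"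
  let ?M = "{m. \<exists>t::real. poly (r * [:-of_real a, 1:]) (of_real t) \<noteq> 0 \<and>
      poly (q + smult l r) (of_real t) + m * poly (r * [:-of_real a, 1:]) (of_real t) = 0}"
  have "simply_attains (p + node_poly S * [:l - m * of_real a, m:]) a' b'" if "m \<notin> ?M" for m
    unfolding simply_attains_def
  proof (intro exI conjI allI)
    show "p + node_poly S * [:l - m * of_real a, m:] = [:b':] + [:-of_real a', 1:] * ?q m"
      unfolding q(1) r(1) by (simp only: algebra_simps)
    fix t :: real
    have *: "poly (?q m) (of_real t) =
        poly (q + smult l r) (of_real t) + m * poly (r * [:-of_real a, 1:]) (of_real t)"
      by (simp add: algebra_simps)
    show "poly (?q m) (of_real t) \<noteq> 0"
    proof (cases "poly (r * [:-of_real a, 1:]) (of_real t) = 0")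
      case False
      with that show ?thesis
        unfolding * by blast
    next
      case True
      then consider "poly r (of_real t) = 0" | "t = a" by auto
      then show ?thesis
      proof cases
        case 1
        then show ?thesis using q(2)[of t] by simp
      next
        case 2
        have "(of_real a - of_real a') * poly (q + smult l r) (of_real a) = b - b'"
          using new(1) unfolding q(1) r(1) by (simp add: algebra_simps)
        then have "poly (q + smult l r) (of_real a) \<noteq> 0"
          using new(2) by (metis eq_iff_diff_eq_0 mult_zero_right)
        then show ?thesis
          unfolding 2 by (simp add: algebra_simps)
      qed
    qed
  qed
  then have "{m. \<not> simply_attains (p + node_poly S * [:l - m * of_real a, m:]) a' b'} \<subseteq> ?M"
    by blast
  then show ?thesis
    using negligible_subset negligible_real_root_parameters by blast
qed

text \<open>With \<open>Q\<close> the node polynomial, the cofactor at \<open>a\<close> is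
  \<open>q + m Q\<close>. At old nodes \<open>m\<close> has no influence, but there the value of
  \<open>p\<close> differs from \<open>b\<close>; at all other real points, including
  \<open>a\<close>, \<open>Q\<close> is nonzero and bad \<open>m\<close> lie on a curve.\<close>

lemma simply_attains_new_node:
  assumes "finite S" "a \<notin> S"
    and old: "\<And>s. s \<in> S \<Longrightarrow> poly p (of_real s) \<noteq> b"
    and new: "poly p (of_real a) + l * poly (node_poly S) (of_real a) = b"
  shows "negligible {m. \<not> simply_attains (p + node_poly S * [:l - m * of_real a, m:]) a b}"
proof -
  have "poly (p + smult l (node_poly S) - [:b:]) (of_real a) = 0"
    using new by simp
  then obtain q where q: "p + smult l (node_poly S) - [:b:] = [:-of_real a, 1:] * q"
    by (metis dvdE poly_eq_0_iff_dvd)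
  let ?q = "\<lambda>m. q + smult m (node_poly S)"
  let ?M = "{m. \<exists>t::real. poly (node_poly S) (of_real t) \<noteq> 0 \<and>
      poly q (of_real t) + m * poly (node_poly S) (of_real t) = 0}"
  have "simply_attains (p + node_poly S * [:l - m * of_real a, m:]) a b" if "m \<notin> ?M" for m
    unfolding simply_attains_def
  proof (intro exI conjI allI)
    have "p + node_poly S * [:l - m * of_real a, m:] =
        [:b:] + (p + smult l (node_poly S) - [:b:]) + smult m (node_poly S * [:-of_real a, 1:])"
      by (intro poly_eq_poly_eq_iff[THEN iffD1] ext) (simp add: algebra_simps)
    then show "p + node_poly S * [:l - m * of_real a, m:] = [:b:] + [:-of_real a, 1:] * ?q m"
      unfolding q by (simp only: algebra_simps mult_smult_right mult_smult_left)
    fix t :: real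
    show "poly (?q m) (of_real t) \<noteq> 0"
    proof (cases "t \<in> S")
      case False
      with that show ?thesis
        using node_poly_real_eq_0_iff[OF assms(1)] by auto
    next
      case True
      then have "poly (node_poly S) (of_real t) = 0"
        using node_poly_real_eq_0_iff[OF assms(1)] by simp
      moreover from this have "poly (p + smult l (node_poly S) - [:b:]) (of_real t) \<noteq> 0"
        using True old by simp
      ultimately show ?thesis
        unfolding q by simp
    qed
  qed
  then have "{m. \<not> simply_attains (p + node_poly S * [:l - m * of_real a, m:]) a b} \<subseteq> ?M"
    by blast
  then show ?thesis
    using negligible_subset negligible_real_root_parameters by blast
qed

section \<open>Adding one pair to an interpolating polynomial\<close>

text \<open>The degree bound lets the node polynomial dominate \<open>p\<close> far out on the real
  line, where a node for a prescribed value is then found.\<close>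

definition interpolant :: "complex \<Rightarrow> complex poly \<Rightarrow> (real \<times> complex) set \<Rightarrow> bool" where
  "interpolant w p G \<longleftrightarrow> finite G \<and> inj_on fst G \<and> inj_on snd G \<and>
     degree p < degree (node_poly (fst ` G)) \<and> poly p \<i> = w \<and>
     (\<forall>(a, b)\<in>G. simply_attains p a b)"

lemma interpolantD:
  assumes "interpolant w p G"
  shows "finite G" "inj_on fst G" "inj_on snd G" "degree p < degree (node_poly (fst ` G))"
    "poly p \<i> = w" "\<And>a b. (a, b) \<in> G \<Longrightarrow> simply_attains p a b"
  using assms by (auto simp: interpolant_def)

lemma interpolant_empty: "interpolant w [:w:] {}"
  by (simp add: interpolant_def node_poly_def)

text \<open>Each of the finitely many pairs excludes a null set of \<open>m\<close>, and a disc of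
  radius \<open>d\<close> is not null.\<close>

lemma interpolant_step:
  assumes G: "interpolant w p G" and "a \<notin> fst ` G" "b \<notin> snd ` G"
    and new: "poly p (of_real a) + l * poly (node_poly (fst ` G)) (of_real a) = b"
    and "d > 0"
  obtains m where "norm m < d"
    "interpolant w (p + node_poly (fst ` G) * [:l - m * of_real a, m:]) (insert (a, b) G)"
proof -
  define S where "S = fst ` G"
  note GD = interpolantD[OF G]
  have S: "finite S" "a \<notin> S"
    using GD(1) assms(2) by (auto simp: S_def)
  let ?p = "\<lambda>m. p + node_poly S * [:l - m * of_real a, m:]"
  have other: "poly p (of_real s) \<noteq> b'" if *: "s \<in> S" "(a', b') \<in> insert (a, b) G" "s \<noteq> a'" for s a' b'
  proof -
    obtain c where c: "(s, c) \<in> G"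
      using *(1) by (auto simp: S_def)
    moreover have "c \<noteq> b'"
      using c * GD(3) assms(3) by (force simp: inj_on_def)
    ultimately show ?thesis
      using simply_attains_eq GD(6) by blast
  qed
  have "negligible {m. \<not> simply_attains (?p m) a' b'}" if "(a', b') \<in> insert (a, b) G" for a' b'
  proof (cases "(a', b') = (a, b)")
    case True
    then show ?thesis
      using simply_attains_new_node[OF S, of p b l] other[of _ a b] new S by (auto simp: S_def)
  next
    case False
    then have "(a', b') \<in> G"
      using that by auto
    then have "a' \<in> S" "b \<noteq> b'"
      using assms(3) by (force simp: S_def)+
    then show ?thesis
      using simply_attains_old_node[OF GD(6)[OF \<open>(a', b') \<in> G\<close>] S(1) _ S(2) other[OF _ that]
          new[folded S_def]]
      by blast
  qed
  then have "negligible (\<Union>(a', b')\<in>insert (a, b) G. {m. \<not> simply_attains (?p m) a' b'})"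
    using GD(1) by (intro negligible_Union) auto
  moreover have "\<not> negligible (ball (0::complex) d)"
    using \<open>d > 0\<close> by (simp add: open_not_negligible)
  ultimately obtain m where m: "m \<in> ball 0 d"
      "m \<notin> (\<Union>(a', b')\<in>insert (a, b) G. {m. \<not> simply_attains (?p m) a' b'})"
    using negligible_subset by blast
  \<comment> \<open>The correction has degree at most one above the old node polynomial, while a new
    double zero raises the degree by two.\<close>
  have "degree (?p m) < degree (node_poly S * [:-of_real a, 1:]^2)"
  proof -
    have "degree (node_poly S * [:l - m * of_real a, m:]) \<le> degree (node_poly S) + 1"
      by (intro order.trans[OF degree_mult_le]) simp
    moreover have "degree (node_poly S * [:-complex_of_real a, 1:]^2) = degree (node_poly S) + 2"
      using S by (subst degree_mult_eq) (auto simp: degree_power_eq)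
    moreover have "degree p < degree (node_poly S)"
      using GD by (simp add: S_def)
    ultimately show ?thesis
      by (intro le_less_trans[OF degree_add_le_max]) linarith
  qed
  then have "interpolant w (?p m) (insert (a, b) G)"
    using m(2) GD S assms(3) node_poly_insert[OF S]
    unfolding interpolant_def S_def by auto
  with m(1) that show ?thesis
    by (simp add: S_def)
qed

section \<open>Stages of the construction and their refinement\<close>

text \<open>The components are the current polynomial, the pairs matched so far, and the scale of
  the tolerance.\<close>

type_synonym stage = "complex poly \<times> (real \<times> complex) set \<times> real"

definition stage_nodes :: "stage \<Rightarrow> (real \<times> complex) set" where
  "stage_nodes s = fst (snd s)"

text \<open>Scaling the modulus of the node polynomial, instead of taking a constant, closes the
  band at every node and at \<open>\<i>\<close>: all functions within it share the exact values
  there.\<close>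

definition tolerance :: "stage \<Rightarrow> complex \<Rightarrow> real" where
  "tolerance s z = snd (snd s) * norm (poly (node_poly (fst ` stage_nodes s)) z)"

text \<open>The power of \<open>1/2\<close> yields locally uniform convergence. The last clause
  keeps every function within the tolerance, hence also the limit, from taking \<open>b\<close> on
  \<open>[-n, n]\<close> away from \<open>a\<close>.\<close>

definition valid_stage :: "complex \<Rightarrow> nat \<Rightarrow> stage \<Rightarrow> bool" where
  "valid_stage w n s \<longleftrightarrow> interpolant w (fst s) (stage_nodes s) \<and> snd (snd s) > 0 \<and>
     (\<forall>z\<in>cball 0 (real n). tolerance s z \<le> (1/2) ^ n) \<and>
     (\<forall>(a, b)\<in>stage_nodes s. \<forall>t\<in>{-real n..real n}. t \<noteq> a \<longrightarrow>
        tolerance s (of_real t) < norm (poly (fst s) (of_real t) - b))"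

text \<open>A refinement shrinks the set of functions that stay within the tolerance on the disc.\<close>

definition refines :: "nat \<Rightarrow> stage \<Rightarrow> stage \<Rightarrow> bool" where
  "refines n s s' \<longleftrightarrow> stage_nodes s \<subseteq> stage_nodes s' \<and>
     (\<forall>z\<in>cball 0 (real n). norm (poly (fst s') z - poly (fst s) z) + tolerance s' z \<le> tolerance s z)"

lemma refines_trans:
  assumes "refines n s s'" "refines n s' s''"
  shows "refines n s s''"
  unfolding refines_def
proof (intro conjI ballI)
  show "stage_nodes s \<subseteq> stage_nodes s''"
    using assms by (auto simp: refines_def)
  fix z :: complex assume z: "z \<in> cball 0 (real n)"
  have "norm (poly (fst s'') z - poly (fst s) z) \<le>
      norm (poly (fst s'') z - poly (fst s') z) + norm (poly (fst s') z - poly (fst s) z)"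
    by norm
  then show "norm (poly (fst s'') z - poly (fst s) z) + tolerance s'' z \<le> tolerance s z"
    using assms z unfolding refines_def by (smt (verit))
qed

lemma refines_mono: "refines n s s' \<Longrightarrow> m \<le> n \<Longrightarrow> refines m s s'"
  by (auto simp: refines_def)

lemma refines_refl: "refines n s s"
  by (simp add: refines_def)

text \<open>Each condition holds for all small positive scales, by compactness and stability, and
  \<open>G\<close> is finite.\<close>

lemma eventually_valid_stage:
  assumes "interpolant w p G"
  shows "eventually (\<lambda>e. valid_stage w n (p, G, e)) (at_right 0)"
proof -
  let ?Q = "node_poly (fst ` G)"
  note GD = interpolantD[OF assms]
  have "eventually (\<lambda>e. \<forall>x\<in>G. case x of (a, b) \<Rightarrow> \<forall>t\<in>{-real n..real n}. t \<noteq> a \<longrightarrow>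
      e * norm (poly ?Q (of_real t)) < norm (poly p (of_real t) - b)) (at_right 0)"
  proof (intro eventually_ball_finite ballI)
    fix x assume x: "x \<in> G"
    obtain a b where ab: "x = (a, b)" by fastforce
    have "(a, b) \<in> G" "a \<in> fst ` G"
      using x by (force simp: ab)+
    then show "eventually (\<lambda>e. case x of (a, b) \<Rightarrow> \<forall>t\<in>{-real n..real n}. t \<noteq> a \<longrightarrow>
        e * norm (poly ?Q (of_real t)) < norm (poly p (of_real t) - b)) (at_right 0)"
      using simply_attains_stable[OF GD(6), of a b "fst ` G" "real n"] GD(1)
      by (simp add: ab)
  qed (use GD in auto)
  moreover have "eventually (\<lambda>e. \<forall>z\<in>cball 0 (real n). e * norm (poly ?Q z) \<le> (1/2) ^ n) (at_right 0)"
  proof -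
    have "bounded (poly ?Q ` cball 0 (real n))"
      by (intro compact_imp_bounded compact_continuous_image continuous_intros compact_cball)
    then obtain M where M: "\<And>z. z \<in> cball 0 (real n) \<Longrightarrow> norm (poly ?Q z) \<le> M"
      by (metis bounded_iff image_eqI)
    have "eventually (\<lambda>e. e * M < (1/2) ^ n) (at_right 0)"
      by (rule eventually_at_right_0_mult_less) simp
    then show ?thesis
      using eventually_at_right_less[of 0]
    proof eventually_elim
      case (elim e)
      show ?case
      proof
        fix z assume "z \<in> cball (0::complex) (real n)"
        then have "e * norm (poly ?Q z) \<le> e * M"
          using M elim by simp
        then show "e * norm (poly ?Q z) \<le> (1/2) ^ n"
          using elim by linarith
      qed
    qed
  qed
  ultimately show ?thesis
    using eventually_at_right_less[of 0]
    by eventually_elim (use assms in \<open>auto simp: valid_stage_def stage_nodes_def tolerance_def\<close>)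
qed

text \<open>After division by the modulus of the node polynomial, the budget \<open>e\<close> is
  split in three: \<open>e/4\<close> for \<open>l\<close>, \<open>e/4\<close> for
  \<open>m (z - a)\<close>, and \<open>e/2\<close> for the new tolerance
  \<open>e' |z - a|^2\<close>.\<close>

lemma exists_stage_adding_pair:
  assumes s: "valid_stage w n s" and "a \<notin> fst ` stage_nodes s" "b \<notin> snd ` stage_nodes s"
    and close: "norm (b - poly (fst s) (of_real a)) < tolerance s (of_real a) / 4"
  obtains s' where "valid_stage w n' s'" "refines n s s'"
    "stage_nodes s' = insert (a, b) (stage_nodes s)"
proof -
  obtain p G e where peG: "s = (p, G, e)"
    by (cases s)
  let ?Q = "node_poly (fst ` G)"
  have G: "interpolant w p G" and e: "e > 0"
    using s by (auto simp: valid_stage_def peG stage_nodes_def)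
  have a: "a \<notin> fst ` G" "b \<notin> snd ` G" "finite (fst ` G)"
    using assms interpolantD[OF G] by (auto simp: peG stage_nodes_def)
  have Qa: "poly ?Q (of_real a) \<noteq> 0"
    using a node_poly_real_eq_0_iff by blast
  define l where "l = (b - poly p (of_real a)) / poly ?Q (of_real a)"
  have l: "poly p (of_real a) + l * poly ?Q (of_real a) = b"
    using Qa by (simp add: l_def)
  have l4: "norm l < e / 4"
    using close Qa by (simp add: l_def norm_divide peG stage_nodes_def tolerance_def divide_simps)
  \<comment> \<open>This bounds \<open>|z - a|\<close> on the disc of radius \<open>n\<close>; the
    summand 1 keeps it positive for the division below.\<close>
  define K where "K = real n + \<bar>a\<bar> + 1"
  have K0: "K > 0"
    by (simp add: K_def)
  have K: "norm (z - of_real a) \<le> K" if "z \<in> cball 0 (real n)" for z :: complex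
    using norm_triangle_ineq4[of z "of_real a"] that by (simp add: K_def)
  obtain m where m: "norm m < e / (4 * K)"
    and G': "interpolant w (p + ?Q * [:l - m * of_real a, m:]) (insert (a, b) G)"
    using interpolant_step[OF G a(1,2) l, of "e / (4 * K)"] e K0 by auto
  have "eventually (\<lambda>e'. e' * K^2 < e / 2) (at_right 0)"
    using e by (intro eventually_at_right_0_mult_less) simp
  then have "eventually (\<lambda>e'. valid_stage w n' (p + ?Q * [:l - m * of_real a, m:], insert (a, b) G, e')
      \<and> e' * K^2 < e / 2) (at_right 0)"
    using eventually_valid_stage[OF G'] by eventually_elim simp
  then obtain e' where e': "valid_stage w n' (p + ?Q * [:l - m * of_real a, m:], insert (a, b) G, e')"
      "e' * K^2 < e / 2"
    using eventually_happens'[of "at_right (0::real)"] trivial_limit_at_right_real by blast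
  have e'0: "e' > 0"
    using e' by (simp add: valid_stage_def)
  have "refines n s (p + ?Q * [:l - m * of_real a, m:], insert (a, b) G, e')"
    unfolding refines_def
  proof (intro conjI ballI)
    fix z :: complex assume z: "z \<in> cball 0 (real n)"
    let ?d = "norm (z - of_real a)"
    have "norm (l + m * (z - of_real a)) \<le> norm l + norm m * ?d"
      by (metis norm_mult norm_triangle_ineq)
    also have "norm m * ?d \<le> e / (4 * K) * K"
      using m K[OF z] K0 e by (intro mult_mono) auto
    also have "e / (4 * K) * K = e / 4"
      using K0 by simp
    finally have 1: "norm (l + m * (z - of_real a)) \<le> e / 2"
      using l4 by simp
    have "e' * ?d ^ 2 \<le> e' * K ^ 2"
      using K[OF z] e'0 by (intro mult_left_mono power_mono) auto
    then have "norm (l + m * (z - of_real a)) + e' * ?d ^ 2 \<le> e"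
      using 1 e' by simp
    then have "norm (poly ?Q z) * (norm (l + m * (z - of_real a)) + e' * ?d ^ 2) \<le> norm (poly ?Q z) * e"
      by (intro mult_left_mono) auto
    moreover have "norm (poly (p + ?Q * [:l - m * of_real a, m:]) z - poly p z) =
        norm (poly ?Q z) * norm (l + m * (z - of_real a))"
      by (simp add: norm_mult[symmetric] algebra_simps)
    moreover have "norm (poly (node_poly (insert a (fst ` G))) z) = norm (poly ?Q z) * ?d ^ 2"
      using a by (simp add: node_poly_insert norm_mult norm_power)
    ultimately show "norm (poly (fst (p + ?Q * [:l - m * of_real a, m:], insert (a, b) G, e')) z -
        poly (fst s) z) + tolerance (p + ?Q * [:l - m * of_real a, m:], insert (a, b) G, e') z
          \<le> tolerance s z"
      unfolding peG tolerance_def stage_nodes_def fst_conv snd_conv image_insert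
      by (simp only: distrib_left mult_ac)
  qed (auto simp: peG stage_nodes_def)
  with e'(1) show ?thesis
    by (rule that) (simp add: peG stage_nodes_def)
qed

text \<open>Only the scale shrinks, which carries a stage over to a larger disc.\<close>

lemma exists_valid_refinement:
  assumes "valid_stage w n s"
  obtains s' where "valid_stage w n' s'" "refines n s s'" "stage_nodes s' = stage_nodes s"
proof -
  obtain p G e where peG: "s = (p, G, e)"
    by (cases s)
  have G: "interpolant w p G" and e: "e > 0"
    using assms by (auto simp: valid_stage_def peG stage_nodes_def)
  have "eventually (\<lambda>e'. e' * 1 < e) (at_right 0)"
    using e by (rule eventually_at_right_0_mult_less)
  then have "eventually (\<lambda>e'. valid_stage w n' (p, G, e') \<and> e' < e) (at_right 0)"
    using eventually_valid_stage[OF G] by eventually_elim simp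
  then obtain e' where e': "valid_stage w n' (p, G, e')" "e' < e"
    using eventually_happens'[of "at_right (0::real)"] trivial_limit_at_right_real by blast
  have "refines n s (p, G, e')"
    using e' by (auto simp: refines_def peG tolerance_def stage_nodes_def intro!: mult_right_mono)
  with e'(1) show ?thesis
    by (rule that) (simp add: peG stage_nodes_def)
qed

lemma tolerance_pos:
  assumes "valid_stage w n s" "a \<notin> fst ` stage_nodes s"
  shows "tolerance s (of_real a) > 0"
  using assms node_poly_real_eq_0_iff[of "fst ` stage_nodes s" a] interpolantD(1)
  by (force simp: valid_stage_def tolerance_def)

section \<open>Forth and back\<close>

text \<open>The tolerance is positive off the nodes, so the disc of admissible values minus the
  finitely many used ones is open and nonempty, and \<open>B\<close> meets it.\<close>

lemma exists_stage_forward: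
  assumes s: "valid_stage w n s" and B: "closure B = (UNIV :: complex set)" and a: "a \<notin> fst ` stage_nodes s"
  obtains s' b where "valid_stage w n s'" "refines n s s'" "b \<in> B"
    "stage_nodes s' = insert (a, b) (stage_nodes s)"
proof -
  let ?U = "ball (poly (fst s) (of_real a)) (tolerance s (of_real a) / 4)"
  have fin: "finite (snd ` stage_nodes s)"
    using s interpolantD(1) by (auto simp: valid_stage_def)
  then have "open (?U - snd ` stage_nodes s)"
    by (intro open_Diff finite_imp_closed) auto
  moreover have "?U - snd ` stage_nodes s \<noteq> {}"
  proof -
    have "uncountable ?U"
      using tolerance_pos[OF s a] by (intro uncountable_ball) simp
    then show ?thesis
      using fin by (metis Diff_eq_empty_iff countable_finite finite_subset)
  qed
  ultimately have "(?U - snd ` stage_nodes s) \<inter> B \<noteq> {}"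
    using open_Int_closure_eq_empty[of "?U - snd ` stage_nodes s" B] B by simp
  then obtain b where b: "b \<in> B" "b \<in> ?U - snd ` stage_nodes s"
    by blast
  then have "b \<notin> snd ` stage_nodes s"
      "norm (b - poly (fst s) (of_real a)) < tolerance s (of_real a) / 4"
    by (auto simp: dist_norm norm_minus_commute)
  from exists_stage_adding_pair[OF s a this, of n] obtain s'
    where s': "valid_stage w n s'" "refines n s s'" "stage_nodes s' = insert (a, b) (stage_nodes s)" .
  show ?thesis
    by (rule that[OF s'(1,2) b(1) s'(3)])
qed

text \<open>By the degree bound \<open>(b - p) / Q\<close> tends to 0 along the real line, so every
  large real point beyond the old nodes is admissible; a dense \<open>A\<close> contains such
  points.\<close>

lemma exists_stage_backward:
  assumes s: "valid_stage w n s" and A: "closure A = (UNIV :: real set)" and b: "b \<notin> snd ` stage_nodes s"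
  obtains s' a where "valid_stage w n s'" "refines n s s'" "a \<in> A"
    "stage_nodes s' = insert (a, b) (stage_nodes s)"
proof -
  obtain p G e where peG: "s = (p, G, e)"
    by (cases s)
  let ?Q = "node_poly (fst ` G)"
  have G: "interpolant w p G" and e: "e > 0"
    using s by (auto simp: valid_stage_def peG stage_nodes_def)
  note GD = interpolantD[OF G]
  have "degree ([:b:] - p) < degree ?Q"
    using GD(4) by (intro le_less_trans[OF degree_diff_le_max]) auto
  then have "((\<lambda>t. poly ([:b:] - p) (complex_of_real t) / poly ?Q (of_real t)) \<longlongrightarrow> 0) at_top"
    by (rule filterlim_compose[OF poly_divide_tendsto_0_at_infinity filterlim_of_real_at_infinity])
  then have "eventually (\<lambda>t. norm (poly ([:b:] - p) (complex_of_real t) / poly ?Q (of_real t)) < e / 4) at_top"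
    using e by (auto simp: tendsto_iff dist_norm dest: spec[of _ "e / 4"])
  moreover have "eventually (\<lambda>t. \<forall>c\<in>fst ` G. t > c) at_top"
    using GD(1) by (intro eventually_ball_finite) (auto intro: eventually_gt_at_top)
  ultimately have "eventually (\<lambda>t. t \<notin> fst ` G \<and> norm (b - poly p (complex_of_real t)) < tolerance s (of_real t) / 4) at_top"
  proof eventually_elim
    case (elim t)
    have t: "t \<notin> fst ` G"
      using elim by blast
    then have "poly ?Q (of_real t) \<noteq> 0"
      using node_poly_real_eq_0_iff GD(1) by blast
    with t elim show ?case
      by (simp add: norm_divide peG stage_nodes_def tolerance_def divide_simps)
  qed
  then obtain N where N: "\<And>t. t \<ge> N \<Longrightarrow> t \<notin> fst ` G \<and>
      norm (b - poly p (complex_of_real t)) < tolerance s (of_real t) / 4"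
    by (auto simp: eventually_at_top_linorder)
  have "A \<inter> {N<..} \<noteq> {}"
    using open_Int_closure_eq_empty[of "{N<..}" A] A by (auto simp: Int_commute)
  then obtain a where a: "a \<in> A" "a \<ge> N"
    by force
  then have "a \<notin> fst ` stage_nodes s"
      "norm (b - poly (fst s) (of_real a)) < tolerance s (of_real a) / 4"
    using N[of a] by (auto simp: peG stage_nodes_def)
  from exists_stage_adding_pair[OF s this(1) b this(2), of n] obtain s'
    where s': "valid_stage w n s'" "refines n s s'" "stage_nodes s' = insert (a, b) (stage_nodes s)" .
  show ?thesis
    by (rule that[OF s'(1,2) a(1) s'(3)])
qed

section \<open>The limit function\<close>

lemma refines_seq:
  assumes "\<And>n. refines n (S n) (S (Suc n))" "n \<le> k"
  shows "refines n (S n) (S k)"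
  using assms(2)
proof (induction k rule: dec_induct)
  case (step k)
  then show ?case
    using refines_trans refines_mono assms(1) by blast
qed (rule refines_refl)

text \<open>Once \<open>n\<close> exceeds \<open>|z|\<close>, all later polynomials stay within the
  tolerance of stage \<open>n\<close>, at most \<open>(1/2) ^ n\<close>. So they converge uniformly
  on discs and the limit is entire.\<close>

lemma stage_sequence_limit:
  assumes valid: "\<And>n. valid_stage w n (S n)" and refines: "\<And>n. refines n (S n) (S (Suc n))"
  obtains F where "F holomorphic_on UNIV" "F \<i> = w"
    "\<And>n z. norm z \<le> real n \<Longrightarrow> norm (F z - poly (fst (S n)) z) \<le> tolerance (S n) z"
proof
  let ?p = "\<lambda>n. poly (fst (S n))"
  let ?F = "\<lambda>z. lim (\<lambda>n. ?p n z)"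
  have le: "norm (?p k z - ?p n z) \<le> tolerance (S n) z" if "n \<le> k" "norm z \<le> real n" for n k z
  proof -
    have "norm (?p k z - ?p n z) + tolerance (S k) z \<le> tolerance (S n) z"
      using refines_seq[of S, OF refines that(1)] that(2) by (simp add: refines_def)
    moreover have "tolerance (S k) z \<ge> 0"
      using valid[of k] by (simp add: tolerance_def valid_stage_def)
    ultimately show ?thesis by linarith
  qed
  have small: "tolerance (S n) z \<le> (1/2) ^ n" if "norm z \<le> real n" for n z
    using valid[of n] that by (simp add: valid_stage_def)
  have conv: "(\<lambda>k. ?p k z) \<longlonglongrightarrow> ?F z" for z
  proof -
    have "Cauchy (\<lambda>k. ?p k z)"
    proof (rule metric_CauchyI)
      fix d :: real assume "d > 0"
      then have "eventually (\<lambda>n. (1/2) ^ n < d / 2) sequentially"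
        by (intro order_tendstoD(2)[OF LIMSEQ_power_zero]) auto
      moreover have "eventually (\<lambda>n. norm z \<le> real n) sequentially"
        by (rule eventually_at_top_linorderI[of "nat \<lceil>norm z\<rceil>"]) linarith
      ultimately obtain n where n: "(1/2) ^ n < d / 2" "norm z \<le> real n"
        using eventually_happens'[OF sequentially_bot eventually_conj] by blast
      have "dist (?p k z) (?p l z) < d" if "k \<ge> n" "l \<ge> n" for k l
      proof -
        have "dist (?p k z) (?p n z) < d / 2" "dist (?p l z) (?p n z) < d / 2"
          using le[OF that(1) n(2)] le[OF that(2) n(2)] small[OF n(2)] n(1) by (auto simp: dist_norm)
        then show ?thesis
          by (rule dist_triangle_half_l)
      qed
      then show "\<exists>n. \<forall>k\<ge>n. \<forall>l\<ge>n. dist (?p k z) (?p l z) < d"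
        by blast
    qed
    then show ?thesis
      using Cauchy_convergent_iff convergent_LIMSEQ_iff by blast
  qed
  show F_le: "norm (?F z - ?p n z) \<le> tolerance (S n) z" if "norm z \<le> real n" for n z
  proof (rule tendsto_upperbound)
    show "(\<lambda>k. norm (?p k z - ?p n z)) \<longlonglongrightarrow> norm (?F z - ?p n z)"
      by (intro tendsto_intros conv)
    show "eventually (\<lambda>k. norm (?p k z - ?p n z) \<le> tolerance (S n) z) sequentially"
      using le that by (auto simp: eventually_at_top_linorder)
  qed simp
  show "?F holomorphic_on UNIV"
  proof (rule holomorphic_uniform_sequence)
    fix x :: complex
    have "uniform_limit (cball x 1) ?p ?F sequentially"
    proof (rule uniform_limitI)
      fix d :: real assume "d > 0"
      then have "eventually (\<lambda>n. (1/2) ^ n < d) sequentially"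
        by (intro order_tendstoD(2)[OF LIMSEQ_power_zero]) auto
      moreover have "eventually (\<lambda>n. norm x + 1 \<le> real n) sequentially"
        by (rule eventually_at_top_linorderI[of "nat \<lceil>norm x + 1\<rceil>"]) linarith
      ultimately show "eventually (\<lambda>n. \<forall>z\<in>cball x 1. dist (?p n z) (?F z) < d) sequentially"
      proof eventually_elim
        case (elim n)
        show ?case
        proof
          fix z assume "z \<in> cball x 1"
          then have "norm z \<le> real n"
            using norm_triangle_sub[of z x] elim by (simp add: dist_norm norm_minus_commute)
          then have "dist (?p n z) (?F z) \<le> (1/2) ^ n"
            unfolding dist_norm norm_minus_commute[of "?p n z"] using F_le small order.trans by blast
          then show "dist (?p n z) (?F z) < d"
            using elim by linarith
        qed
      qed
    qed
    then show "\<exists>d>0. cball x d \<subseteq> UNIV \<and> uniform_limit (cball x d) ?p ?F sequentially"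
      by (intro exI[of _ 1]) simp
  qed (auto intro!: holomorphic_intros)
  have "?p n \<i> = w" for n
    using valid[of n] by (auto simp: valid_stage_def dest: interpolantD)
  then show "?F \<i> = w"
    by simp
qed

text \<open>At \<open>a\<close> the tolerance is zero, so the limit inherits the value
  \<open>b\<close>; at other points of \<open>[-n, n]\<close> the tolerance is smaller than the
  distance of the polynomial from \<open>b\<close>.\<close>

lemma stage_sequence_limit_attains:
  assumes valid: "\<And>n. valid_stage w n (S n)" and refines: "\<And>n. refines n (S n) (S (Suc n))"
    and F: "\<And>n z. norm z \<le> real n \<Longrightarrow> norm (F z - poly (fst (S n)) z) \<le> tolerance (S n) z"
    and ab: "(a, b) \<in> stage_nodes (S k)"
  shows "F (of_real t) = b \<longleftrightarrow> t = a"
proof -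
  \<comment> \<open>Late enough for the pair to be present and for both \<open>a\<close> and
    \<open>t\<close> to lie in \<open>[-n, n]\<close>.\<close>
  define n where "n = max k (max (nat \<lceil>\<bar>a\<bar>\<rceil>) (nat \<lceil>\<bar>t\<bar>\<rceil>))"
  have n: "k \<le> n" "\<bar>a\<bar> \<le> real n" "\<bar>t\<bar> \<le> real n"
    unfolding n_def by linarith+
  have abn: "(a, b) \<in> stage_nodes (S n)"
    using refines_seq[of S, OF refines n(1)] ab by (auto simp: refines_def)
  have I: "interpolant w (fst (S n)) (stage_nodes (S n))"
    using valid[of n] by (simp add: valid_stage_def)
  have "poly (fst (S n)) (of_real a) = b"
    using interpolantD(6)[OF I abn] simply_attains_eq by blast
  moreover have "tolerance (S n) (of_real a) = 0"
    using abn node_poly_real_eq_0_iff[of "fst ` stage_nodes (S n)" a] interpolantD(1)[OF I]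
    by (force simp: tolerance_def)
  ultimately have "F (of_real a) = b"
    using F[of "of_real a" n] n by simp
  moreover have "F (of_real t) \<noteq> b" if "t \<noteq> a"
  proof -
    have "\<forall>(a, b)\<in>stage_nodes (S n). \<forall>t\<in>{-real n..real n}. t \<noteq> a \<longrightarrow>
        tolerance (S n) (of_real t) < norm (poly (fst (S n)) (of_real t) - b)"
      using valid[of n] by (simp add: valid_stage_def)
    then have "tolerance (S n) (of_real t) < norm (poly (fst (S n)) (of_real t) - b)"
      using abn that n(3) by (auto simp: abs_le_iff)
    then show ?thesis
      using F[of "of_real t" n] n(3) by (auto simp: norm_minus_commute)
  qed
  ultimately show ?thesis
    by blast
qed

lemma dense_imp_nonempty: "closure X = (UNIV :: 'a::real_normed_vector set) \<Longrightarrow> X \<noteq> {}"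
  by auto

text \<open>One back-and-forth over the unions of all \<open>A j\<close> and all \<open>B j\<close>
  serves every index at once: only points of equal index are paired, and disjointness makes the
  index of a point unique.\<close>

lemma exists_entire_maps_bijectively:
  fixes A :: "nat \<Rightarrow> real set" and B :: "nat \<Rightarrow> complex set"
  assumes A_disj: "disjoint_family_on A {1..}"
    and A: "\<And>j. j \<ge> 1 \<Longrightarrow> countable (A j) \<and> closure (A j) = UNIV"
    and B_disj: "disjoint_family_on B {1..}"
    and B: "\<And>j. j \<ge> 1 \<Longrightarrow> countable (B j) \<and> closure (B j) = UNIV"
  obtains F where "F holomorphic_on UNIV" "F \<i> = w" "maps_bijectively A B F"
proof -
  define matched where "matched = (\<lambda>(a, b). \<exists>j\<ge>1. a \<in> A j \<and> b \<in> B j)"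
  have unique_A: "j = j'" if "j \<ge> 1" "a \<in> A j" "j' \<ge> 1" "a \<in> A j'" for j j' a
    using disjoint_family_onD[OF A_disj, of j j'] that by auto
  have unique_B: "j = j'" if "j \<ge> 1" "b \<in> B j" "j' \<ge> 1" "b \<in> B j'" for j j' b
    using disjoint_family_onD[OF B_disj, of j j'] that by auto
  let ?A = "\<Union>j\<in>{1..}. A j" and ?B = "\<Union>j\<in>{1..}. B j"
  have "countable ?A" "countable ?B"
    using A B by auto
  moreover have "?A \<noteq> {}" "?B \<noteq> {}"
    using dense_imp_nonempty[of "A 1"] dense_imp_nonempty[of "B 1"] A[of 1] B[of 1] by auto
  ultimately obtain \<alpha> :: "nat \<Rightarrow> real" and \<beta> :: "nat \<Rightarrow> complex" where ab: "range \<alpha> = ?A" "range \<beta> = ?B"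
    using that[of "from_nat_into ?A" "from_nat_into ?B"] range_from_nat_into by metis
  define good where "good = (\<lambda>n s. valid_stage w n s \<and> (\<forall>x\<in>stage_nodes s. matched x))"
  have forward: "\<exists>s'. good n s' \<and> refines n s s' \<and> a \<in> fst ` stage_nodes s'"
    if h: "good n s" "a \<in> ?A" for n s a
  \<comment> \<open>The point may already be matched, for instance as the partner of an earlier
    value; then the stage is kept.\<close>
  proof (cases "a \<in> fst ` stage_nodes s")
    case True
    then show ?thesis using h refines_refl by blast
  next
    case False
    obtain j where j: "j \<ge> 1" "a \<in> A j"
      using h by auto
    have "valid_stage w n s"
      using h(1) by (simp add: good_def)
    from exists_stage_forward[OF this conjunct2[OF B[OF j(1)]] False] obtain s' b
      where "valid_stage w n s'" "refines n s s'" "b \<in> B j"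
        "stage_nodes s' = insert (a, b) (stage_nodes s)" .
    then show ?thesis
      using j h(1) by (intro exI[of _ s']) (auto simp: good_def matched_def)
  qed
  have backward: "\<exists>s'. good n s' \<and> refines n s s' \<and> b \<in> snd ` stage_nodes s'"
    if h: "good n s" "b \<in> ?B" for n s b
  proof (cases "b \<in> snd ` stage_nodes s")
    case True
    then show ?thesis using h refines_refl by blast
  next
    case False
    obtain j where j: "j \<ge> 1" "b \<in> B j"
      using h by auto
    have "valid_stage w n s"
      using h(1) by (simp add: good_def)
    from exists_stage_backward[OF this conjunct2[OF A[OF j(1)]] False] obtain s' a
      where "valid_stage w n s'" "refines n s s'" "a \<in> A j"
        "stage_nodes s' = insert (a, b) (stage_nodes s)" .
    then show ?thesis
      using j h(1) by (intro exI[of _ s']) (auto simp: good_def matched_def)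
  qed
  have "\<exists>S. \<forall>n. good n (S n) \<and> (refines n (S n) (S (Suc n)) \<and>
      \<alpha> n \<in> fst ` stage_nodes (S (Suc n)) \<and> \<beta> n \<in> snd ` stage_nodes (S (Suc n)))"
  proof (rule dependent_nat_choice)
    have "\<exists>e. valid_stage w 0 ([:w:], {}, e)"
      using eventually_happens'[OF _ eventually_valid_stage[OF interpolant_empty]]
        trivial_limit_at_right_real by blast
    then show "\<exists>s. good 0 s"
      by (auto simp: good_def stage_nodes_def)
  next
    fix s n assume s: "good n s"
    have "\<alpha> n \<in> ?A" "\<beta> n \<in> ?B"
      unfolding ab[symmetric] by (rule rangeI)+
    from forward[OF s this(1)] obtain s1
      where s1: "good n s1" "refines n s s1" "\<alpha> n \<in> fst ` stage_nodes s1"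
      by blast
    from backward[OF s1(1) \<open>\<beta> n \<in> ?B\<close>] obtain s2
      where s2: "good n s2" "refines n s1 s2" "\<beta> n \<in> snd ` stage_nodes s2"
      by blast
    have "valid_stage w n s2"
      using s2(1) by (simp add: good_def)
    \<comment> \<open>Both extensions took place on the disc of radius \<open>n\<close>; now the
      stage is made valid on the next one.\<close>
    from exists_valid_refinement[OF this, of "Suc n"] obtain s3
      where s3: "valid_stage w (Suc n) s3" "refines n s2 s3" "stage_nodes s3 = stage_nodes s2" .
    have "refines n s s3"
      by (rule refines_trans[OF refines_trans[OF s1(2) s2(2)] s3(2)])
    moreover have "\<alpha> n \<in> fst ` stage_nodes s3"
      using s1(3) s2(2) s3(3) by (auto simp: refines_def)
    ultimately show "\<exists>s'. good (Suc n) s' \<and> refines n s s' \<and>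
        \<alpha> n \<in> fst ` stage_nodes s' \<and> \<beta> n \<in> snd ` stage_nodes s'"
      using s2 s3 unfolding good_def by metis
  qed
  then obtain S where S: "\<And>n. good n (S n)" "\<And>n. refines n (S n) (S (Suc n))"
      "\<And>n. \<alpha> n \<in> fst ` stage_nodes (S (Suc n))" "\<And>n. \<beta> n \<in> snd ` stage_nodes (S (Suc n))"
    by blast
  have valid: "valid_stage w n (S n)" for n
    using S(1) by (simp add: good_def)
  obtain F where F: "F holomorphic_on UNIV" "F \<i> = w"
      "\<And>n z. norm z \<le> real n \<Longrightarrow> norm (F z - poly (fst (S n)) z) \<le> tolerance (S n) z"
    using stage_sequence_limit[of w S, OF valid S(2)] by blast
  have attains: "F (of_real t) = b \<longleftrightarrow> t = a" if "(a, b) \<in> stage_nodes (S k)" for t a b k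
    using stage_sequence_limit_attains[of w S F, OF valid S(2) F(3) that] by blast
  have fwd: "F (of_real a) \<in> B j \<and> (\<forall>t. F (of_real t) = F (of_real a) \<longrightarrow> t = a)"
    if h: "j \<ge> 1" "a \<in> A j" for a j
  proof -
    have "a \<in> range \<alpha>"
      unfolding ab using h by auto
    then obtain n where "a = \<alpha> n"
      by blast
    then obtain b where b: "(a, b) \<in> stage_nodes (S (Suc n))"
      using S(3)[of n] by auto
    then have "matched (a, b)"
      using S(1) by (auto simp: good_def)
    then obtain j' where j': "j' \<ge> 1" "a \<in> A j'" "b \<in> B j'"
      by (auto simp: matched_def)
    have "j = j'"
      by (rule unique_A[OF h]) (use j' in auto)
    have Fa: "F (of_real a) = b"
      using attains[OF b, of a] by simp
    show ?thesis
      unfolding Fa using attains[OF b] \<open>b \<in> B j'\<close> \<open>j = j'\<close> by blast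
  qed
  have bwd: "\<exists>a\<in>A j. \<forall>t. F (of_real t) = b \<longleftrightarrow> t = a" if h: "j \<ge> 1" "b \<in> B j" for b j
  proof -
    have "b \<in> range \<beta>"
      unfolding ab using h by auto
    then obtain n where "b = \<beta> n"
      by blast
    then obtain a where a: "(a, b) \<in> stage_nodes (S (Suc n))"
      using S(4)[of n] by auto
    then have "matched (a, b)"
      using S(1) by (auto simp: good_def)
    then obtain j' where j': "j' \<ge> 1" "a \<in> A j'" "b \<in> B j'"
      by (auto simp: matched_def)
    have "j = j'"
      by (rule unique_B[OF h]) (use j' in auto)
    then show ?thesis
      using attains[OF a] j'(2) by blast
  qed
  have "maps_bijectively A B F"
    unfolding maps_bijectively_def
  proof (intro allI impI conjI)
    fix j :: nat assume j: "j \<ge> 1"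
    show "bij_betw F (complex_of_real ` A j) (B j)"
      unfolding bij_betw_def
    proof (intro conjI inj_onI)
      show "x = y" if "x \<in> complex_of_real ` A j" "y \<in> complex_of_real ` A j" "F x = F y" for x y
        using that fwd[OF j] by (metis imageE)
      show "F ` complex_of_real ` A j = B j"
      proof (intro equalityI subsetI)
        fix b assume "b \<in> B j"
        then obtain a where "a \<in> A j" "F (of_real a) = b"
          using bwd[OF j] by blast
        then show "b \<in> F ` complex_of_real ` A j"
          by blast
      qed (use fwd[OF j] in blast)
    qed
    show "F -` B j \<inter> \<real> = complex_of_real ` A j"
    proof (intro equalityI subsetI)
      fix x assume "x \<in> F -` B j \<inter> \<real>"
      then obtain t where t: "x = of_real t" "F (of_real t) \<in> B j"
        by (auto elim: Reals_cases)
      \<comment> \<open>The value at \<open>t\<close> has a single real preimage, and that one lies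
        in \<open>A j\<close>.\<close>
      from bwd[OF j t(2)] obtain a where "a \<in> A j" "t = a"
        by blast
      then show "x \<in> complex_of_real ` A j"
        using t(1) by blast
    qed (use fwd[OF j] in auto)
  qed
  with F that show ?thesis
    by blast
qed

section \<open>Transcendence of the limits\<close>

text \<open>A nonconstant polynomial is proper, so its image of the real line meets a disc in a closed null
  set, which cannot be dense in that disc.\<close>

lemma poly_image_reals_not_dense:
  fixes p :: "complex poly"
  shows "closure (poly p ` \<real>) \<noteq> UNIV"
proof (cases "degree p = 0")
  case True
  then obtain c where "p = [:c:]"
    by (metis degree_eq_zeroE)
  then have "closure (poly p ` \<real>) \<subseteq> {c}"
    by (intro closure_minimal) auto
  then show ?thesis
    by (metis UNIV_I singletonD subsetD one_neq_zero)
next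
  case False
  then have "filterlim (poly p) at_infinity at_infinity"
    by (intro filterlim_poly_at_infinity) simp
  then have "eventually (\<lambda>z. norm (poly p z) \<ge> 1) at_infinity"
    by (simp add: filterlim_at_infinity_conv_norm_at_top filterlim_at_top)
  then obtain R where R: "\<And>z. norm z \<ge> R \<Longrightarrow> norm (poly p z) \<ge> 1"
    by (auto simp: eventually_at_infinity)
  let ?K = "(\<lambda>t. poly p (complex_of_real t)) ` {-R..R}"
  have "compact ?K"
    by (intro compact_continuous_image continuous_intros) auto
  have "negligible ?K"
    by (intro negligible_real_curve) (auto simp: differentiable_on_def intro: derivative_intros)
  have "ball 0 1 \<inter> poly p ` \<real> \<subseteq> ?K"
  proof
    fix x assume "x \<in> ball 0 1 \<inter> poly p ` \<real>"
    then obtain t where t: "x = poly p (complex_of_real t)" "norm x < 1"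
      by (auto elim!: Reals_cases)
    then have "\<bar>t\<bar> < R"
      using R[of "of_real t"] by force
    then show "x \<in> ?K"
      using t by (auto simp: abs_less_iff intro!: image_eqI[of _ _ t])
  qed
  show ?thesis
  proof
    assume "closure (poly p ` \<real>) = UNIV"
    then have "ball 0 1 \<subseteq> closure (ball 0 1 \<inter> poly p ` \<real>)"
      using open_Int_closure_subset[of "ball 0 1" "poly p ` \<real>"] by simp
    also have "\<dots> \<subseteq> ?K"
      using \<open>compact ?K\<close> \<open>ball 0 1 \<inter> poly p ` \<real> \<subseteq> ?K\<close>
      by (intro closure_minimal compact_imp_closed)
    finally have "negligible (ball (0::complex) 1)"
      using \<open>negligible ?K\<close> negligible_subset by blast
    then show False
      by (simp add: open_not_negligible)
  qed
qed

text \<open>The dense set \<open>B 1\<close> lies in the image of the real line.\<close>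

lemma maps_bijectively_imp_not_poly:
  assumes "maps_bijectively A B f" "closure (B 1) = UNIV"
  shows "\<not> (\<exists>p :: complex poly. \<forall>z. f z = poly p z)"
proof
  assume "\<exists>p :: complex poly. \<forall>z. f z = poly p z"
  then obtain p where "f = poly p" by auto
  moreover have "B 1 = f ` complex_of_real ` A 1"
    using assms(1) by (auto simp: maps_bijectively_def bij_betw_def)
  then have "B 1 \<subseteq> f ` \<real>"
    by (auto simp: Reals_def)
  ultimately show False
    using poly_image_reals_not_dense[of p] closure_mono[of "B 1" "f ` \<real>"] assms(2)
    by (simp add: top.extremum_unique)
qed

section \<open>Counting the functions\<close>

text \<open>Identity theorem: density puts points of \<open>A\<close> in every interval
  \<open>(0, e)\<close>, so 0 is a limit point of the set of agreement.\<close>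

lemma entire_eq_if_eq_on_dense_reals:
  assumes "f holomorphic_on UNIV" "g holomorphic_on UNIV" "closure A = (UNIV :: real set)"
    and eq: "\<And>a. a \<in> A \<Longrightarrow> f (of_real a) = g (of_real a)"
  shows "f = g"
proof
  fix w
  have islimpt: "complex_of_real 0 islimpt complex_of_real ` A"
    unfolding islimpt_approachable
  proof (intro allI impI)
    fix e :: real assume "e > 0"
    then have "{0<..<e} \<inter> A \<noteq> {}"
      using open_Int_closure_eq_empty[of "{0<..<e}" A] assms(3) by simp
    then obtain a where "a \<in> A" "0 < a" "a < e"
      by auto
    then show "\<exists>x\<in>complex_of_real ` A. x \<noteq> of_real 0 \<and> dist x (of_real 0) < e"
      by (auto intro!: bexI[of _ a])
  qed
  have "f w - g w = 0"
    by (rule analytic_continuation[OF _ _ _ _ _ islimpt, where f = "\<lambda>z. f z - g z" and S = UNIV])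
       (auto intro!: holomorphic_intros assms(1,2) simp: eq)
  then show "f w = g w"
    by simp
qed

text \<open>A function is determined by its restriction to \<open>A 1\<close>, a map between
  countable sets, whose graph \<open>h\<close> encodes as a set of naturals.\<close>

lemma entire_maps_bijectively_lepoll:
  assumes A: "countable (A 1)" "closure (A 1) = UNIV" and B: "countable (B 1)"
  shows "{f. f holomorphic_on UNIV \<and> maps_bijectively A B f} \<lesssim> (UNIV :: real set)"
proof -
  let ?X = "{f. f holomorphic_on UNIV \<and> maps_bijectively A B f}"
  define h where "h f = {prod_encode (m, n) |m n.
      f (complex_of_real (from_nat_into (A 1) m)) = from_nat_into (B 1) n}" for f
  have "inj_on h ?X"
  proof (rule inj_onI)
    fix f g assume f: "f \<in> ?X" and g: "g \<in> ?X" and "h f = h g"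
    show "f = g"
    proof (rule entire_eq_if_eq_on_dense_reals[OF _ _ A(2)])
      fix a assume a: "a \<in> A 1"
      obtain m where m: "from_nat_into (A 1) m = a"
        using from_nat_into_surj[OF A(1) a] by blast
      have "bij_betw f (complex_of_real ` A 1) (B 1)"
        using f by (simp add: maps_bijectively_def)
      then have "f (of_real a) \<in> B 1"
        using a by (auto simp: bij_betw_def)
      then obtain n where n: "from_nat_into (B 1) n = f (of_real a)"
        using from_nat_into_surj[OF B] by blast
      then have "prod_encode (m, n) \<in> h f"
        using m by (auto simp: h_def)
      then have "prod_encode (m, n) \<in> h g"
        using \<open>h f = h g\<close> by simp
      then show "f (of_real a) = g (of_real a)"
        using m n by (auto simp: h_def)
    qed (use f g in auto)
  qed
  then have "?X \<lesssim> (UNIV :: nat set set)"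
    unfolding lepoll_def by blast
  then show ?thesis
    using nat_sets_eqpoll_reals lepoll_trans2 by blast
qed

theorem proposition2p7:
  fixes A :: "nat \<Rightarrow> real set" and B :: "nat \<Rightarrow> complex set"
  assumes "disjoint_family_on A {1..}"
    and "\<And>j. j \<ge> 1 \<Longrightarrow> countable (A j) \<and> closure (A j) = UNIV"
    and "disjoint_family_on B {1..}"
    and "\<And>j. j \<ge> 1 \<Longrightarrow> countable (B j) \<and> closure (B j) = UNIV"
  shows "(\<exists>f. transcendental_entire f \<and> maps_bijectively A B f) \<and>
         {f. transcendental_entire f \<and> maps_bijectively A B f} \<approx> (UNIV :: real set)"
proof
  let ?X = "{f. transcendental_entire f \<and> maps_bijectively A B f}"
  \<comment> \<open>Density of \<open>B 1\<close> makes every entire solution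
    transcendental.\<close>
  have X: "?X = {f. f holomorphic_on UNIV \<and> maps_bijectively A B f}"
    using maps_bijectively_imp_not_poly assms(4)[of 1] by (auto simp: transcendental_entire_def)
  have "\<exists>f\<in>?X. f \<i> = of_real w" for w :: real
    using exists_entire_maps_bijectively[OF assms, of "of_real w"] unfolding X by auto
  then obtain F where F: "\<And>w::real. F w \<in> ?X" "\<And>w::real. F w \<i> = of_real w"
    by metis
  show "\<exists>f. transcendental_entire f \<and> maps_bijectively A B f"
    using F(1) by blast
  \<comment> \<open>Functions for different \<open>w\<close> differ at \<open>\<i>\<close>, which
    gives the lower bound on the cardinality.\<close>
  have "inj F"
    using F(2) by (metis injI of_real_eq_iff)
  then have "(UNIV :: real set) \<lesssim> ?X"
    using F(1) unfolding lepoll_def by blast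
  moreover have "?X \<lesssim> (UNIV :: real set)"
    unfolding X using assms(2)[of 1] assms(4)[of 1] by (intro entire_maps_bijectively_lepoll) auto
  ultimately show "?X \<approx> (UNIV :: real set)"
    by (intro lepoll_antisym)
qed

end
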